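(* Let $X$ be a set, and $S$ any finite subset of the free monoid $\langle X\rangle$. Then there is a finite overlap-free subset $T$ of $\langle X\rangle\setminus\{1\}$ which is inverse-equivalent to $S$. Such a $T$ can be constructed algorithmically from $S$.
   Context: "Inverse" and "invertible" mean two-sided unless modified. For a monoid $M$ and a subset $S\subseteq M$, $M\langle\mathbf{i}(S)\rangle$ denotes the monoid obtained from $M$ by universally adjoining a two-sided inverse $\mathbf{i}(w)$ to each $w\in S$; it comes with a natural homomorphism from $M$ (not necessarily injective). Two subsets $S,S'$ of a monoid $M$ are called inverse-equivalent if the images of all elements of $S'$ are invertible in $M\langle\mathbf{i}(S)\rangle$ and the images of all elements of $S$ are invertible in $M\langle\mathbf{i}(S')\rangle$. $\langle X\rangle$ is the free monoid on $X$. Two nonidentity elements of $\langle X\rangle$ (possibly equal) are said to overlap if one of them can be written $ab$ and the other $bc$ with $a,b,c\in\langle X\rangle$, $b\neq 1$, and at most one of $a$ and $c$ equal to $1$. A subset $T\subseteq\langle X\rangle\setminus\{1\}$ is overlap-free if no pair of elements of $T$ (distinct or not) overlap. *)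

theory Defs
  imports "HOL-Algebra.Group" "HOL-Library.Nat_Bijection"
begin

section \<open>Universal adjunction of inverses\<close>

definition free_monoid :: "'a set \<Rightarrow> 'a list monoid" where
  "free_monoid X = \<lparr>carrier = lists X, monoid.mult = (@), one = []\<rparr>"

text \<open>
  \<open>M\<langle>i(S)\<rangle>\<close> is given by the presentation with a generator \<open>Elem x\<close> for every \<open>x\<close> in \<open>M\<close>, a
  generator \<open>Inv w\<close> for every \<open>w\<close> in \<open>S\<close>, the multiplication table of \<open>M\<close> as relations, and the
  relations making \<open>Inv w\<close> a two-sided inverse of \<open>Elem w\<close>.  The universal property is verified in
  the theorems \<open>adjoin_universal\<close> and \<open>adjoin_universal_unique\<close>.
\<close>

datatype 'a adjoin_gen = Elem 'a | Inv 'a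

definition adjoin_words :: "('a, 'm) monoid_scheme \<Rightarrow> 'a set \<Rightarrow> 'a adjoin_gen list set" where
  "adjoin_words M S = lists (Elem ` carrier M \<union> Inv ` S)"

inductive_set adjoin_cong ::
  "('a, 'm) monoid_scheme \<Rightarrow> 'a set \<Rightarrow> ('a adjoin_gen list \<times> 'a adjoin_gen list) set"
  for M (structure) and S where
  one: "([Elem \<one>], []) \<in> adjoin_cong M S"
| mult: "x \<in> carrier M \<Longrightarrow> y \<in> carrier M \<Longrightarrow> ([Elem x, Elem y], [Elem (x \<otimes> y)]) \<in> adjoin_cong M S"
| r_inv: "w \<in> S \<Longrightarrow> ([Elem w, Inv w], []) \<in> adjoin_cong M S"
| l_inv: "w \<in> S \<Longrightarrow> ([Inv w, Elem w], []) \<in> adjoin_cong M S"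
| refl: "u \<in> adjoin_words M S \<Longrightarrow> (u, u) \<in> adjoin_cong M S"
| sym: "(u, v) \<in> adjoin_cong M S \<Longrightarrow> (v, u) \<in> adjoin_cong M S"
| trans: "(u, v) \<in> adjoin_cong M S \<Longrightarrow> (v, w) \<in> adjoin_cong M S \<Longrightarrow> (u, w) \<in> adjoin_cong M S"
| append: "(u, u') \<in> adjoin_cong M S \<Longrightarrow> (v, v') \<in> adjoin_cong M S \<Longrightarrow>
    (u @ v, u' @ v') \<in> adjoin_cong M S"

definition adjoin_inverses ::
  "('a, 'm) monoid_scheme \<Rightarrow> 'a set \<Rightarrow> 'a adjoin_gen list set monoid" where
  "adjoin_inverses M S =
     \<lparr>carrier = adjoin_words M S // adjoin_cong M S,
      monoid.mult = (\<lambda>A B. adjoin_cong M S `` {u @ v | u v. u \<in> A \<and> v \<in> B}),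
      one = adjoin_cong M S `` {[]}\<rparr>"

definition adjoin_map :: "('a, 'm) monoid_scheme \<Rightarrow> 'a set \<Rightarrow> 'a \<Rightarrow> 'a adjoin_gen list set" where
  "adjoin_map M S x = adjoin_cong M S `` {[Elem x]}"

definition inverse_equivalent :: "('a, 'm) monoid_scheme \<Rightarrow> 'a set \<Rightarrow> 'a set \<Rightarrow> bool" where
  "inverse_equivalent M S S' \<longleftrightarrow>
     (\<forall>s\<in>S'. adjoin_map M S s \<in> Units (adjoin_inverses M S)) \<and>
     (\<forall>s\<in>S. adjoin_map M S' s \<in> Units (adjoin_inverses M S'))"

lemma adjoin_cong_words:
  assumes "monoid M" "S \<subseteq> carrier M" "(u, v) \<in> adjoin_cong M S"
  shows "u \<in> adjoin_words M S \<and> v \<in> adjoin_words M S"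
proof -
  interpret monoid M by fact
  show ?thesis using assms(3)
    by induction (use assms(2) in \<open>auto simp: adjoin_words_def\<close>)
qed

lemma equiv_adjoin_cong:
  assumes "monoid M" "S \<subseteq> carrier M"
  shows "equiv (adjoin_words M S) (adjoin_cong M S)"
proof (rule equivI)
  show "adjoin_cong M S \<subseteq> adjoin_words M S \<times> adjoin_words M S"
    using adjoin_cong_words[OF assms] by auto
  show "refl_on (adjoin_words M S) (adjoin_cong M S)"
    by (auto intro: refl_onI adjoin_cong.refl)
  show "sym (adjoin_cong M S)" by (auto intro: symI adjoin_cong.sym)
  show "trans (adjoin_cong M S)" by (auto intro: transI adjoin_cong.trans)
qed

lemma adjoin_mult_class:
  assumes "monoid M" "S \<subseteq> carrier M" "u \<in> adjoin_words M S" "v \<in> adjoin_words M S"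
  shows "adjoin_cong M S `` {u} \<otimes>\<^bsub>adjoin_inverses M S\<^esub> adjoin_cong M S `` {v}
           = adjoin_cong M S `` {u @ v}"
proof -
  have "(w \<in> adjoin_cong M S `` {a @ b | a b. a \<in> adjoin_cong M S `` {u} \<and> b \<in> adjoin_cong M S `` {v}})
      \<longleftrightarrow> w \<in> adjoin_cong M S `` {u @ v}" for w
  proof
    assume "w \<in> adjoin_cong M S `` {a @ b | a b. a \<in> adjoin_cong M S `` {u} \<and> b \<in> adjoin_cong M S `` {v}}"
    then obtain a b where "(u, a) \<in> adjoin_cong M S" "(v, b) \<in> adjoin_cong M S"
      "(a @ b, w) \<in> adjoin_cong M S" by auto
    then show "w \<in> adjoin_cong M S `` {u @ v}"
      by (auto intro: adjoin_cong.trans adjoin_cong.append)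
  next
    assume "w \<in> adjoin_cong M S `` {u @ v}"
    then show "w \<in> adjoin_cong M S `` {a @ b | a b. a \<in> adjoin_cong M S `` {u} \<and> b \<in> adjoin_cong M S `` {v}}"
      using adjoin_cong.refl[OF assms(3)] adjoin_cong.refl[OF assms(4)] by blast
  qed
  then show ?thesis by (auto simp: adjoin_inverses_def)
qed

lemma adjoin_words_append:
  "u @ v \<in> adjoin_words M S \<longleftrightarrow> u \<in> adjoin_words M S \<and> v \<in> adjoin_words M S"
  by (auto simp: adjoin_words_def)

lemma adjoin_carrierE:
  assumes "A \<in> carrier (adjoin_inverses M S)"
  obtains u where "u \<in> adjoin_words M S" "A = adjoin_cong M S `` {u}"
  using assms by (auto simp: adjoin_inverses_def elim: quotientE)

lemma adjoin_class_in_carrier: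
  "u \<in> adjoin_words M S \<Longrightarrow> adjoin_cong M S `` {u} \<in> carrier (adjoin_inverses M S)"
  by (auto simp: adjoin_inverses_def intro: quotientI)

lemma monoid_adjoin_inverses:
  assumes "monoid M" "S \<subseteq> carrier M"
  shows "monoid (adjoin_inverses M S)"
proof -
  have one: "\<one>\<^bsub>adjoin_inverses M S\<^esub> = adjoin_cong M S `` {[]}"
    by (simp add: adjoin_inverses_def)
  have nil: "[] \<in> adjoin_words M S" by (simp add: adjoin_words_def)
  show ?thesis
    by (rule monoidI)
      (auto elim!: adjoin_carrierE simp: one nil adjoin_mult_class[OF assms] adjoin_words_append
            intro!: adjoin_class_in_carrier)
qed

lemma adjoin_map_hom:
  assumes "monoid M" "S \<subseteq> carrier M"
  shows "adjoin_map M S \<in> hom M (adjoin_inverses M S)"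
    and "adjoin_map M S \<one>\<^bsub>M\<^esub> = \<one>\<^bsub>adjoin_inverses M S\<^esub>"
proof -
  note cls = equiv_class_eq[OF equiv_adjoin_cong[OF assms]]
  have E: "[Elem x] \<in> adjoin_words M S" if "x \<in> carrier M" for x
    using that by (auto simp: adjoin_words_def)
  show "adjoin_map M S \<one>\<^bsub>M\<^esub> = \<one>\<^bsub>adjoin_inverses M S\<^esub>"
    unfolding adjoin_map_def using cls[OF adjoin_cong.one] by (simp add: adjoin_inverses_def)
  show "adjoin_map M S \<in> hom M (adjoin_inverses M S)"
  proof (rule homI)
    fix x y assume xy: "x \<in> carrier M" "y \<in> carrier M"
    then show "adjoin_map M S (x \<otimes>\<^bsub>M\<^esub> y) = adjoin_map M S x \<otimes>\<^bsub>adjoin_inverses M S\<^esub> adjoin_map M S y"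
      unfolding adjoin_map_def adjoin_mult_class[OF assms E E, OF xy]
      using cls[OF adjoin_cong.mult[OF xy]] by simp
  qed (auto simp: adjoin_map_def intro!: adjoin_class_in_carrier E)
qed

lemma adjoin_map_Units:
  assumes "monoid M" "S \<subseteq> carrier M" "w \<in> S"
  shows "adjoin_map M S w \<in> Units (adjoin_inverses M S)"
proof -
  note cls = equiv_class_eq[OF equiv_adjoin_cong[OF assms(1,2)]]
  have E: "[Elem w] \<in> adjoin_words M S" "[Inv w] \<in> adjoin_words M S"
    using assms by (auto simp: adjoin_words_def)
  have one: "\<one>\<^bsub>adjoin_inverses M S\<^esub> = adjoin_cong M S `` {[]}"
    by (simp add: adjoin_inverses_def)
  show ?thesis
    unfolding Units_def adjoin_map_def mem_Collect_eq
    by (intro conjI bexI[of _ "adjoin_cong M S `` {[Inv w]}"])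
      (simp_all add: adjoin_class_in_carrier E adjoin_mult_class[OF assms(1,2)] one
        cls[OF adjoin_cong.r_inv[OF assms(3)]] cls[OF adjoin_cong.l_inv[OF assms(3)]])
qed

theorem adjoin_universal:
  fixes M :: "('a, 'm) monoid_scheme" and N :: "('b, 'n) monoid_scheme"
  assumes "monoid M" "S \<subseteq> carrier M" "monoid N"
    and h: "h \<in> hom M N" "h \<one>\<^bsub>M\<^esub> = \<one>\<^bsub>N\<^esub>" "h ` S \<subseteq> Units N"
  shows "\<exists>k \<in> hom (adjoin_inverses M S) N. k \<one>\<^bsub>adjoin_inverses M S\<^esub> = \<one>\<^bsub>N\<^esub> \<and>
           (\<forall>x\<in>carrier M. k (adjoin_map M S x) = h x)"
proof -
  interpret N: monoid N by fact
  define g where "g a = (case a of Elem x \<Rightarrow> h x | Inv w \<Rightarrow> inv\<^bsub>N\<^esub> h w)" for a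
  define ev where "ev us = foldr (\<lambda>a n. g a \<otimes>\<^bsub>N\<^esub> n) us \<one>\<^bsub>N\<^esub>" for us
  have gc: "g a \<in> carrier N" if "a \<in> Elem ` carrier M \<union> Inv ` S" for a
    using that h assms(2) by (auto simp: g_def hom_def)
  have evc: "ev u \<in> carrier N" if "u \<in> adjoin_words M S" for u
    using that unfolding adjoin_words_def
    by (induction u) (auto simp: ev_def intro!: N.m_closed gc)
  have ev_app: "ev (u @ v) = ev u \<otimes>\<^bsub>N\<^esub> ev v"
    if "u \<in> adjoin_words M S" "v \<in> adjoin_words M S" for u v
  proof -
    have "ev v \<in> carrier N" using that(2) by (rule evc)
    with that(1) show ?thesis
    proof (induction u)
      case (Cons a u)
      then have "u \<in> adjoin_words M S" "g a \<in> carrier N"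
        using gc by (auto simp: adjoin_words_def)
      with Cons evc[of u] show ?case by (simp add: ev_def N.m_assoc)
    qed (simp add: ev_def)
  qed
  have ev_cong: "ev u = ev v" if "(u, v) \<in> adjoin_cong M S" for u v
    using that
  proof induction
    case (mult x y)
    then show ?case using h by (auto simp: ev_def g_def hom_def Pi_def)
  next
    case (r_inv w)
    then have "h w \<in> Units N" using h by auto
    then show ?case by (simp add: ev_def g_def N.Units_closed)
  next
    case (l_inv w)
    then have "h w \<in> Units N" using h by auto
    then show ?case by (simp add: ev_def g_def N.Units_closed)
  next
    case (append u u' v v')
    then show ?case using adjoin_cong_words[OF assms(1,2)] by (simp add: ev_app)
  qed (simp_all add: ev_def g_def h(2))
  define k where "k A = ev (SOME u. u \<in> A)" for A
  have k: "k (adjoin_cong M S `` {u}) = ev u" if "u \<in> adjoin_words M S" for u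
  proof -
    have "(SOME v. v \<in> adjoin_cong M S `` {u}) \<in> adjoin_cong M S `` {u}"
      by (rule someI[of _ u]) (simp add: adjoin_cong.refl that)
    then show ?thesis unfolding k_def using ev_cong by auto
  qed
  have "k \<in> hom (adjoin_inverses M S) N"
    by (auto intro!: homI elim!: adjoin_carrierE
        simp: adjoin_mult_class[OF assms(1,2)] k evc ev_app adjoin_words_append)
  moreover have "k \<one>\<^bsub>adjoin_inverses M S\<^esub> = \<one>\<^bsub>N\<^esub>"
    using k[of "[]"] by (simp add: adjoin_inverses_def adjoin_words_def ev_def)
  moreover have "k (adjoin_map M S x) = h x" if "x \<in> carrier M" for x
  proof -
    have "h x \<in> carrier N" using that h by (auto simp: hom_def)
    moreover have "[Elem x] \<in> adjoin_words M S" using that by (auto simp: adjoin_words_def)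
    ultimately show ?thesis by (simp add: adjoin_map_def k ev_def g_def)
  qed
  ultimately show ?thesis by blast
qed

theorem adjoin_universal_unique:
  fixes M :: "('a, 'm) monoid_scheme" and N :: "('b, 'n) monoid_scheme"
  assumes "monoid M" "S \<subseteq> carrier M" "monoid N"
    and k: "k \<in> hom (adjoin_inverses M S) N" "k \<one>\<^bsub>adjoin_inverses M S\<^esub> = \<one>\<^bsub>N\<^esub>"
    and k': "k' \<in> hom (adjoin_inverses M S) N" "k' \<one>\<^bsub>adjoin_inverses M S\<^esub> = \<one>\<^bsub>N\<^esub>"
    and eq: "\<And>x. x \<in> carrier M \<Longrightarrow> k (adjoin_map M S x) = k' (adjoin_map M S x)"
    and A: "A \<in> carrier (adjoin_inverses M S)"
  shows "k A = k' A"
proof -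
  interpret N: monoid N by fact
  let ?c = "\<lambda>u. adjoin_cong M S `` {u}"
  note m = adjoin_mult_class[OF assms(1,2)]
  note cls = equiv_class_eq[OF equiv_adjoin_cong[OF assms(1,2)]]
  have hc: "f (?c (u @ v)) = f (?c u) \<otimes>\<^bsub>N\<^esub> f (?c v)" "f (?c u) \<in> carrier N"
    if "f \<in> hom (adjoin_inverses M S) N" "u \<in> adjoin_words M S" "v \<in> adjoin_words M S" for f u v
    using that m[OF that(2,3)] adjoin_class_in_carrier[of u M S] adjoin_class_in_carrier[of v M S]
    by (auto simp: hom_def Pi_def simp flip: m[OF that(2,3)])
  have gen: "k (?c [a]) = k' (?c [a])" if "a \<in> Elem ` carrier M \<union> Inv ` S" for a
  proof (cases a)
    case (Elem x)
    then show ?thesis using that eq[of x] by (auto simp: adjoin_map_def)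
  next
    case (Inv w)
    then have w: "w \<in> S" using that by auto
    then have W: "[Elem w] \<in> adjoin_words M S" "[Inv w] \<in> adjoin_words M S"
      using assms(2) by (auto simp: adjoin_words_def)
    have inv: "f (?c [Elem w]) \<otimes>\<^bsub>N\<^esub> f (?c [Inv w]) = \<one>\<^bsub>N\<^esub>"
              "f (?c [Inv w]) \<otimes>\<^bsub>N\<^esub> f (?c [Elem w]) = \<one>\<^bsub>N\<^esub>"
      if "f \<in> hom (adjoin_inverses M S) N" "f \<one>\<^bsub>adjoin_inverses M S\<^esub> = \<one>\<^bsub>N\<^esub>" for f
      using hc(1)[OF that(1) W] hc(1)[OF that(1) W(2,1)] that(2)
        cls[OF adjoin_cong.r_inv[OF w]] cls[OF adjoin_cong.l_inv[OF w]]
      by (auto simp: adjoin_inverses_def)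
    have "k (?c [Elem w]) = k' (?c [Elem w])"
      using w assms(2) eq[of w] by (auto simp: adjoin_map_def)
    then show ?thesis
      using N.inv_unique[of "k (?c [Inv w])" "k (?c [Elem w])" "k' (?c [Inv w])"]
        inv[OF k] inv[OF k'] hc(2)[OF k(1) W] hc(2)[OF k(1) W(2,1)] hc(2)[OF k'(1) W(2,1)] Inv
      by simp
  qed
  obtain u where u: "u \<in> adjoin_words M S" "A = ?c u" using A by (rule adjoin_carrierE)
  have "k (?c u) = k' (?c u)" using u(1)
  proof (induction u)
    case Nil
    then show ?case using k(2) k'(2) by (simp add: adjoin_inverses_def)
  next
    case (Cons a u)
    then have "[a] \<in> adjoin_words M S" "u \<in> adjoin_words M S"
      "a \<in> Elem ` carrier M \<union> Inv ` S" by (auto simp: adjoin_words_def)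
    with Cons.IH gen[of a] hc(1)[OF k(1), of "[a]" u] hc(1)[OF k'(1), of "[a]" u]
    show ?case by simp
  qed
  then show ?thesis using u(2) by simp
qed

section \<open>Overlaps\<close>

text \<open>The condition \<open>b \<noteq> []\<close> forces both words to be nonidentity elements.\<close>

definition overlap :: "'a list \<Rightarrow> 'a list \<Rightarrow> bool" where
  "overlap u v \<longleftrightarrow>
     (\<exists>a b c. b \<noteq> [] \<and> \<not> (a = [] \<and> c = []) \<and>
        (u = a @ b \<and> v = b @ c \<or> v = a @ b \<and> u = b @ c))"

definition overlap_free :: "'a list set \<Rightarrow> bool" where
  "overlap_free T \<longleftrightarrow> (\<forall>u\<in>T. \<forall>v\<in>T. \<not> overlap u v)"

section \<open>Computable functions\<close>

text \<open>
  Kleene's total general recursive functions.  Argument tuples are lists of arbitrary length, a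
  missing argument being read as \<open>0\<close>; this avoids indexing the functions by their arity.
  Minimization is restricted to regular functions, so that only total functions arise.
\<close>

definition nth_arg :: "nat \<Rightarrow> nat list \<Rightarrow> nat" where
  "nth_arg i xs = (if i < length xs then xs ! i else 0)"

inductive general_recursive :: "(nat list \<Rightarrow> nat) \<Rightarrow> bool" where
  zero: "general_recursive (\<lambda>xs. 0)"
| succ: "general_recursive (\<lambda>xs. Suc (nth_arg 0 xs))"
| proj: "general_recursive (nth_arg i)"
| comp: "general_recursive g \<Longrightarrow> \<forall>f\<in>set fs. general_recursive f \<Longrightarrow>
    general_recursive (\<lambda>xs. g (map (\<lambda>f. f xs) fs))"
| prec: "general_recursive f \<Longrightarrow> general_recursive g \<Longrightarrow>
    general_recursive (\<lambda>xs. rec_nat (f (tl xs)) (\<lambda>n r. g (r # n # tl xs)) (nth_arg 0 xs))"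
| minimize: "general_recursive f \<Longrightarrow> \<forall>xs. \<exists>n. f (n # xs) = 0 \<Longrightarrow>
    general_recursive (\<lambda>xs. LEAST n. f (n # xs) = 0)"

definition encode_words :: "nat list list \<Rightarrow> nat" where
  "encode_words ws = list_encode (map list_encode ws)"

definition computable_on_words :: "(nat list list \<Rightarrow> nat list list) \<Rightarrow> bool" where
  "computable_on_words F \<longleftrightarrow>
     (\<exists>g. general_recursive g \<and> (\<forall>ws. g [encode_words ws] = encode_words (F ws)))"

text \<open>
  An algorithm operates on lists \<open>ws\<close> of words whose letters are code numbers; a decoding \<open>d\<close> of
  these numbers as letters, injective on the letters that occur in the input, turns such a list into
  a finite set of words.  Every finite set of words arises in this way, over any alphabet.
\<close>

definition letters :: "'a list list \<Rightarrow> 'a set" where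
  "letters ws = \<Union> (set ` set ws)"

definition decode_words :: "(nat \<Rightarrow> 'a) \<Rightarrow> nat list list \<Rightarrow> 'a list set" where
  "decode_words d ws = map d ` set ws"

end

theory Submission
  imports Defs
begin

text \<open>
  If \<open>ab\<close> and \<open>bc\<close> are invertible, then \<open>b\<close> is left and right invertible, so \<open>a\<close>, \<open>b\<close>, \<open>c\<close> are
  invertible.  Let \<open>C\<close> be the closure of \<open>S\<close> under passing from \<open>ab, bc\<close> with \<open>b \<noteq> 1\<close> to \<open>a, b, c\<close>;
  it is finite because it consists of subwords of elements of \<open>S\<close>.  Let \<open>T\<close> be the set of
  nonidentity elements of \<open>C\<close> that are not products of two nonidentity elements of \<open>C\<close>.  An overlap
  in \<open>T\<close> would decompose one of its two words inside \<open>C\<close>, so \<open>T\<close> is overlap-free; every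
  element of \<open>T\<close> becomes invertible with \<open>S\<close>, and \<open>S\<close> lies in the submonoid generated by \<open>T\<close>.
  For computability no iteration needs to be coded: a list that enumerates \<open>C\<close>, each entry coming from
  \<open>S\<close> or from earlier entries, certifies \<open>T\<close>.  Checking a certificate only involves bounded
  quantifiers, and the algorithm searches for the first certificate.
\<close>

section \<open>Overlap closure\<close>

lemma (in monoid) Units_of_overlap:
  assumes c: "x \<in> carrier G" "y \<in> carrier G" "z \<in> carrier G"
    and xy: "x \<otimes> y \<in> Units G" and yz: "y \<otimes> z \<in> Units G"
  shows "x \<in> Units G" "y \<in> Units G" "z \<in> Units G"
proof -
  define l where "l = inv (x \<otimes> y) \<otimes> x"
  define r where "r = z \<otimes> inv (y \<otimes> z)"
  have lr: "l \<in> carrier G" "r \<in> carrier G"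
    using c xy yz by (auto simp: l_def r_def)
  have ly: "l \<otimes> y = \<one>"
    using Units_l_inv[OF xy] c xy by (simp add: l_def m_assoc)
  have yr: "y \<otimes> r = \<one>"
    using Units_r_inv[OF yz] c yz by (simp add: r_def m_assoc[symmetric])
  have "l = r" by (rule inv_unique[OF ly yr]) (use c lr in auto)
  with ly yr c lr show y: "y \<in> Units G" by (auto simp: Units_def)
  have "x = (x \<otimes> y) \<otimes> inv y" using c y by (simp add: m_assoc)
  then show "x \<in> Units G" using xy y by (metis Units_m_closed Units_inv_Units)
  have "z = inv y \<otimes> (y \<otimes> z)" using c y by (simp add: m_assoc[symmetric])
  then show "z \<in> Units G" using yz y by (metis Units_m_closed Units_inv_Units)
qed

text \<open>
  \<open>overlap_at n u v\<close> says that \<open>u = ab\<close>, \<open>v = bc\<close> with \<open>b \<noteq> 1\<close> and \<open>a\<close> of length \<open>n\<close>.  Unlike in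
  \<open>overlap\<close>, the case \<open>a = c = 1\<close> is allowed; it only adds the empty word to the closure.
\<close>

definition overlap_at :: "nat \<Rightarrow> 'a list \<Rightarrow> 'a list \<Rightarrow> bool" where
  "overlap_at n u v \<longleftrightarrow> n < length u \<and> take (length u - n) v = drop n u"

text \<open>If \<open>u = ab\<close> and \<open>v = bc\<close> overlap at \<open>n\<close>, these
  are \<open>a\<close>, \<open>b\<close> and \<open>c\<close>, because \<open>b\<close> has length
  \<open>length u - n\<close>.\<close>

definition pieces :: "nat \<Rightarrow> 'a list \<Rightarrow> 'a list \<Rightarrow> 'a list set" where
  "pieces n u v = {take n u, drop n u, drop (length u - n) v}"

definition overlap_closed :: "'a list set \<Rightarrow> bool" where
  "overlap_closed C \<longleftrightarrow> (\<forall>u\<in>C. \<forall>v\<in>C. \<forall>n. overlap_at n u v \<longrightarrow> pieces n u v \<subseteq> C)"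

definition irreducibles :: "'a list set \<Rightarrow> 'a list set" where
  "irreducibles C = {w \<in> C. w \<noteq> [] \<and> (\<forall>u\<in>C. \<forall>v\<in>C. u \<noteq> [] \<longrightarrow> v \<noteq> [] \<longrightarrow> w \<noteq> u @ v)}"

lemma overlap_at_append: "b \<noteq> [] \<Longrightarrow> overlap_at (length a) (a @ b) (b @ c)"
  by (simp add: overlap_at_def)

lemma overlap_atE:
  assumes "overlap_at n u v"
  obtains a b c where "u = a @ b" "v = b @ c" "b \<noteq> []" "pieces n u v = {a, b, c}"
proof
  show "u = take n u @ drop n u" by simp
  show "v = drop n u @ drop (length u - n) v"
    using assms by (metis overlap_at_def append_take_drop_id)
  show "drop n u \<noteq> []" using assms by (simp add: overlap_at_def)
qed (simp add: pieces_def)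

lemma overlap_closedD:
  assumes "overlap_closed C" "a @ b \<in> C" "b @ c \<in> C" "b \<noteq> []"
  shows "a \<in> C" "b \<in> C" "c \<in> C"
proof -
  have "pieces (length a) (a @ b) (b @ c) \<subseteq> C"
    using assms overlap_at_append unfolding overlap_closed_def by blast
  then show "a \<in> C" "b \<in> C" "c \<in> C" by (simp_all add: pieces_def)
qed

text \<open>Strong induction on length: a nonempty reducible word splits into two nonempty, hence
  shorter, members of \<open>C\<close>. Thus the irreducibles generate every word of
  \<open>C\<close>.\<close>

lemma irreducibles_induct [consumes 1, case_names Nil irreducible append]:
  assumes "w \<in> C"
    and "P []"
    and "\<And>w. w \<in> irreducibles C \<Longrightarrow> P w"
    and "\<And>u v. u \<in> C \<Longrightarrow> v \<in> C \<Longrightarrow> P u \<Longrightarrow> P v \<Longrightarrow> P (u @ v)"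
  shows "P w"
  using assms(1)
proof (induction "length w" arbitrary: w rule: less_induct)
  case less
  show ?case
  proof (cases "w = [] \<or> w \<in> irreducibles C")
    case False
    then obtain u v where "u \<in> C" "v \<in> C" "u \<noteq> []" "v \<noteq> []" "w = u @ v"
      using less.prems by (auto simp: irreducibles_def)
    then show ?thesis using less.hyps by (intro assms(4)[of u v, folded \<open>w = u @ v\<close>]) auto
  next
    case True
    with assms(2,3) show ?thesis by blast
  qed
qed

text \<open>Closure and irreducibility are taken before decoding, overlaps after it. An overlap of
  decoded words lifts along \<open>d\<close>, which is injective on the letters, and closure puts
  its three pieces into \<open>C\<close>.\<close>

lemma overlap_free_irreducibles:
  assumes "overlap_closed C" "C \<subseteq> lists L" "inj_on d L"
  shows "overlap_free (map d ` irreducibles C)"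
proof -
  have False
    if u: "u \<in> irreducibles C" and v: "v \<in> irreducibles C" and "b \<noteq> []" "\<not> (a = [] \<and> c = [])"
      and uab: "map d u = a @ b" and vbc: "map d v = b @ c" for u v a b c
  proof -
    obtain a' b' where u': "u = a' @ b'" "map d a' = a" "map d b' = b"
      using uab by (auto simp: map_eq_append_conv)
    obtain b'' c' where v': "v = b'' @ c'" "map d b'' = b" "map d c' = c"
      using vbc by (auto simp: map_eq_append_conv)
    have uvC: "u \<in> C" "v \<in> C" using u v by (auto simp: irreducibles_def)
    then have "set u \<subseteq> L" "set v \<subseteq> L" using assms(2) by auto
    then have "set b' \<union> set b'' \<subseteq> L" by (auto simp: u' v')
    then have "b'' = b'"
      using u' v' inj_on_subset[OF assms(3)] by (metis inj_on_map_eq_map)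
    then have C: "a' \<in> C" "b' \<in> C" "c' \<in> C"
      using overlap_closedD[OF assms(1), of a' b' c'] uvC u' v' \<open>b \<noteq> []\<close> by auto
    \<comment> \<open>If \<open>a\<close> is nonempty then \<open>u\<close> splits in
      \<open>C\<close>; otherwise \<open>c\<close> is nonempty and \<open>v\<close> splits.\<close>
    show False
      using C u v u' v' \<open>b'' = b'\<close> \<open>b \<noteq> []\<close> \<open>\<not> (a = [] \<and> c = [])\<close>
      by (auto simp: irreducibles_def)
  qed
  \<comment> \<open>The claim treats one orientation; the other disjunct of \<open>overlap\<close>
    is the claim with \<open>u\<close> and \<open>v\<close> exchanged.\<close>
  then have "\<not> overlap (map d u) (map d v)" if "u \<in> irreducibles C" "v \<in> irreducibles C" for u v
    using that unfolding overlap_def by metis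
  then show ?thesis by (simp add: overlap_free_def)
qed

section \<open>Derivations and certificates\<close>

definition derivation :: "'a list list \<Rightarrow> 'a list list \<Rightarrow> bool" where
  "derivation ws cs \<longleftrightarrow> (\<forall>j<length cs. cs ! j \<in> set ws \<or>
     (\<exists>u\<in>set (take j cs). \<exists>v\<in>set (take j cs). \<exists>n<length u.
        overlap_at n u v \<and> cs ! j \<in> pieces n u v))"

text \<open>The derivation keeps \<open>cs\<close> inside the overlap closure of \<open>ws\<close>,
  and the other two conditions on \<open>cs\<close> make it contain that closure. Hence
  \<open>set cs\<close> is the closure and \<open>ts\<close> lists its irreducibles.\<close>

definition certificate :: "'a list list \<Rightarrow> 'a list list \<Rightarrow> 'a list list \<Rightarrow> bool" where
  "certificate ws cs ts \<longleftrightarrow> set ws \<subseteq> set cs \<and> derivation ws cs \<and> overlap_closed (set cs) \<and>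
     set ts = irreducibles (set cs)"

lemma derivation_induct [consumes 2, case_names base overlap]:
  assumes "derivation ws cs" "w \<in> set cs"
    and base: "\<And>w. w \<in> set ws \<Longrightarrow> P w"
    and step: "\<And>a b c w. P (a @ b) \<Longrightarrow> P (b @ c) \<Longrightarrow> b \<noteq> [] \<Longrightarrow> w \<in> {a, b, c} \<Longrightarrow> P w"
  shows "P w"
proof -
  have "P (cs ! j)" if "j < length cs" for j
    using that
  proof (induction j rule: less_induct)
    case (less j)
    have prev: "P u" if "u \<in> set (take j cs)" for u
      using that less by (auto simp: in_set_conv_nth)
    from assms(1) less.prems consider "cs ! j \<in> set ws"
      | u v n where "u \<in> set (take j cs)" "v \<in> set (take j cs)" "overlap_at n u v"
          "cs ! j \<in> pieces n u v"
      unfolding derivation_def by blast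
    then show ?case
    proof cases
      case 2
      from 2(3) obtain a b c where "u = a @ b" "v = b @ c" "b \<noteq> []" "pieces n u v = {a, b, c}"
        by (rule overlap_atE)
      with 2 show ?thesis using step[of a b c "cs ! j"] prev by blast
    qed (rule base)
  qed
  then show ?thesis using assms(2) by (auto simp: in_set_conv_nth)
qed

text \<open>One step of saturation: the new word is justified by the old entries, and old positions
  keep their prefixes.\<close>

lemma derivation_snoc:
  assumes "derivation ws cs"
    and "w \<in> set ws \<or> (\<exists>u\<in>set cs. \<exists>v\<in>set cs. \<exists>n. overlap_at n u v \<and> w \<in> pieces n u v)"
  shows "derivation ws (cs @ [w])"
  unfolding derivation_def
proof (intro allI impI)
  fix j assume "j < length (cs @ [w])"
  then consider "j < length cs" | "j = length cs" by fastforce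
  then show "(cs @ [w]) ! j \<in> set ws \<or>
     (\<exists>u\<in>set (take j (cs @ [w])). \<exists>v\<in>set (take j (cs @ [w])). \<exists>n<length u.
        overlap_at n u v \<and> (cs @ [w]) ! j \<in> pieces n u v)"
  proof cases
    case 1
    then show ?thesis using assms(1) by (simp add: derivation_def nth_append)
  next
    case 2
    have "n < length u" if "overlap_at n u v" for n and u v :: "'a list"
      using that by (simp add: overlap_at_def)
    with 2 show ?thesis using assms(2) by simp blast
  qed
qed

text \<open>Derivable words lie in a finite set, so repetition-free derivations have bounded length.
  A longest one is saturated, since a missing word could be appended to it.\<close>

lemma certificate_exists: "\<exists>cs ts. certificate ws cs ts"
proof -
  \<comment> \<open>The inserted 0 gives \<open>Max\<close> a value when \<open>ws\<close> is empty.
    Pieces have no new letters and no greater length, so \<open>B\<close> contains all derivable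
    words.\<close>
  define m where "m = Max (insert 0 (length ` set ws))"
  define B where "B = {w. set w \<subseteq> letters ws \<and> length w \<le> m}"
  have "finite B" unfolding B_def
    by (rule finite_lists_length_le) (simp add: letters_def)
  have sub: "set cs \<subseteq> B" if "derivation ws cs" for cs
  proof
    fix w assume "w \<in> set cs"
    with that show "w \<in> B"
    proof (induction rule: derivation_induct)
      case (base w)
      then show ?case by (auto simp: B_def m_def letters_def)
    qed (auto simp: B_def)
  qed
  have "\<forall>cs. derivation ws cs \<and> distinct cs \<longrightarrow> length cs < Suc (card B)"
    using sub card_mono[OF \<open>finite B\<close>] by (auto simp: less_Suc_eq_le simp flip: distinct_card)
  moreover have "derivation ws [] \<and> distinct []" by (simp add: derivation_def)
  ultimately obtain cs where cs: "derivation ws cs" "distinct cs"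
    and max: "\<And>cs'. derivation ws cs' \<Longrightarrow> distinct cs' \<Longrightarrow> length cs' \<le> length cs"
    using ex_has_greatest_nat[of "\<lambda>cs. derivation ws cs \<and> distinct cs" "[]" length] by blast
  have mem: "w \<in> set cs"
    if "w \<in> set ws \<or> (\<exists>u\<in>set cs. \<exists>v\<in>set cs. \<exists>n. overlap_at n u v \<and> w \<in> pieces n u v)" for w
    using max[OF derivation_snoc[OF cs(1) that]] cs(2) by auto
  have "finite (irreducibles (set cs))" by (simp add: irreducibles_def)
  then obtain ts where "set ts = irreducibles (set cs)" using finite_list by blast
  moreover have "set ws \<subseteq> set cs" using mem by blast
  moreover have "overlap_closed (set cs)" unfolding overlap_closed_def using mem by blast
  ultimately show ?thesis using cs by (auto simp: certificate_def)
qed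

section \<open>Inverse equivalence\<close>

lemma monoid_free_monoid: "monoid (free_monoid X)"
  by (rule monoidI) (auto simp: free_monoid_def)

lemma free_monoid_sel [simp]:
  "carrier (free_monoid X) = lists X" "u \<otimes>\<^bsub>free_monoid X\<^esub> v = u @ v" "\<one>\<^bsub>free_monoid X\<^esub> = []"
  by (simp_all add: free_monoid_def)

lemma adjoin_map_free_monoid:
  assumes "S \<subseteq> lists X"
  shows "u \<in> lists X \<Longrightarrow> adjoin_map (free_monoid X) S u \<in> carrier (adjoin_inverses (free_monoid X) S)"
    and "u \<in> lists X \<Longrightarrow> v \<in> lists X \<Longrightarrow> adjoin_map (free_monoid X) S (u @ v) =
      adjoin_map (free_monoid X) S u \<otimes>\<^bsub>adjoin_inverses (free_monoid X) S\<^esub> adjoin_map (free_monoid X) S v"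
    and "adjoin_map (free_monoid X) S [] = \<one>\<^bsub>adjoin_inverses (free_monoid X) S\<^esub>"
proof -
  have S: "S \<subseteq> carrier (free_monoid X)" using assms by simp
  note h = adjoin_map_hom[OF monoid_free_monoid S]
  show "u \<in> lists X \<Longrightarrow> adjoin_map (free_monoid X) S u \<in> carrier (adjoin_inverses (free_monoid X) S)"
    using hom_in_carrier[OF h(1), of u] by simp
  show "u \<in> lists X \<Longrightarrow> v \<in> lists X \<Longrightarrow> adjoin_map (free_monoid X) S (u @ v) =
      adjoin_map (free_monoid X) S u \<otimes>\<^bsub>adjoin_inverses (free_monoid X) S\<^esub> adjoin_map (free_monoid X) S v"
    using hom_mult[OF h(1), of u v] by simp
  show "adjoin_map (free_monoid X) S [] = \<one>\<^bsub>adjoin_inverses (free_monoid X) S\<^esub>"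
    using h(2) by simp
qed

lemma derivation_map_lists:
  assumes "derivation ws cs" "map d ` set ws \<subseteq> lists X" "w \<in> set cs"
  shows "map d w \<in> lists X"
  using assms(1,3)
proof (induction rule: derivation_induct)
  case (base w)
  then show ?case using assms(2) by blast
qed auto

text \<open>The first half of inverse equivalence: starting from \<open>S\<close>, invertibility
  spreads along the derivation by \<open>Units_of_overlap\<close>.\<close>

lemma derivation_Units:
  assumes "derivation ws cs" "S = map d ` set ws" "S \<subseteq> lists X" "w \<in> set cs"
  shows "adjoin_map (free_monoid X) S (map d w) \<in> Units (adjoin_inverses (free_monoid X) S)"
proof -
  have S: "S \<subseteq> carrier (free_monoid X)" using assms by simp
  interpret N: monoid "adjoin_inverses (free_monoid X) S"
    by (rule monoid_adjoin_inverses[OF monoid_free_monoid S])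
  note h = adjoin_map_free_monoid[OF assms(3)]
  \<comment> \<open>Membership in \<open>lists X\<close> is carried through the induction because
    \<open>adjoin_map\<close> is known to split over concatenation for words over
    \<open>X\<close>.\<close>
  have "map d w \<in> lists X \<and>
    adjoin_map (free_monoid X) S (map d w) \<in> Units (adjoin_inverses (free_monoid X) S)"
    using assms(1,4)
  proof (induction rule: derivation_induct)
    case (base w)
    then show ?case
      using adjoin_map_Units[OF monoid_free_monoid S, of "map d w"] assms(2,3) by auto
  next
    case (overlap a b c w)
    have X: "map d a \<in> lists X" "map d b \<in> lists X" "map d c \<in> lists X"
      using overlap by auto
    note N.Units_of_overlap[OF h(1)[OF X(1)] h(1)[OF X(2)] h(1)[OF X(3)]]
    moreover note h(2)[OF X(1,2)] h(2)[OF X(2,3)]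
    ultimately show ?case using overlap X by (auto simp del: in_lists_conv_set)
  qed
  then show ?thesis by blast
qed

text \<open>The converse half: units are closed under products, so inverting the irreducibles
  inverts everything they generate.\<close>

lemma irreducibles_Units:
  assumes "map d ` C \<subseteq> lists X" "T = map d ` irreducibles C" "w \<in> C"
  shows "adjoin_map (free_monoid X) T (map d w) \<in> Units (adjoin_inverses (free_monoid X) T)"
proof -
  have TX: "T \<subseteq> lists X" using assms by (auto simp: irreducibles_def)
  then have T: "T \<subseteq> carrier (free_monoid X)" by simp
  interpret N: monoid "adjoin_inverses (free_monoid X) T"
    by (rule monoid_adjoin_inverses[OF monoid_free_monoid T])
  note h = adjoin_map_free_monoid[OF TX]
  show ?thesis using assms(3)
  proof (induction rule: irreducibles_induct)
    case (irreducible w)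
    then show ?case using adjoin_map_Units[OF monoid_free_monoid T] assms(2) by blast
  next
    case (append u v)
    then have "map d u \<in> lists X" "map d v \<in> lists X" using assms(1) by blast+
    then show ?case using append by (simp add: h(2))
  qed (simp add: h(3))
qed

lemma certificate_sound:
  assumes cert: "certificate ws cs ts" and inj: "inj_on d (letters ws)"
    and S: "S = map d ` set ws" "S \<subseteq> lists X" and T: "T = map d ` set ts"
  shows "finite T \<and> T \<subseteq> lists X - {[]} \<and> overlap_free T \<and> inverse_equivalent (free_monoid X) S T"
proof -
  have c: "set ws \<subseteq> set cs" "derivation ws cs" "overlap_closed (set cs)"
    and T': "T = map d ` irreducibles (set cs)"
    using cert T by (auto simp: certificate_def)
  have X: "map d ` set cs \<subseteq> lists X"
    using derivation_map_lists[OF c(2), of d X] S by blast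
  \<comment> \<open>With \<open>id\<close> as the map, this shows that the closure uses only letters
    of \<open>ws\<close>, where \<open>d\<close> is injective.\<close>
  have "map id ` set ws \<subseteq> lists (letters ws)" by (auto simp: letters_def)
  from derivation_map_lists[OF c(2) this] have "set cs \<subseteq> lists (letters ws)" by auto
  from overlap_free_irreducibles[OF c(3) this inj] have "overlap_free T" by (simp add: T')
  moreover have "T \<subseteq> lists X - {[]}" using X by (auto simp: T' irreducibles_def)
  moreover have "inverse_equivalent (free_monoid X) S T"
    unfolding inverse_equivalent_def
  proof (intro conjI ballI)
    fix t assume "t \<in> T"
    then show "adjoin_map (free_monoid X) S t \<in> Units (adjoin_inverses (free_monoid X) S)"
      using derivation_Units[OF c(2) S] by (auto simp: T' irreducibles_def)
  next
    fix s assume "s \<in> S"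
    then show "adjoin_map (free_monoid X) T s \<in> Units (adjoin_inverses (free_monoid X) T)"
      using irreducibles_Units[OF X T'] S c(1) by auto
  qed
  ultimately show ?thesis using T by simp
qed

section \<open>Recursive functions and decidable relations\<close>

lemma nth_arg_Cons [simp]:
  "nth_arg 0 (x # xs) = x" "nth_arg (Suc i) (x # xs) = nth_arg i xs"
  by (auto simp: nth_arg_def)

lemma nth_arg_tl: "nth_arg i (tl xs) = nth_arg (Suc i) xs"
  by (cases xs) (auto simp: nth_arg_def)

text \<open>Induction on the construction: argument lists have any length, but each rule consults
  only finitely many positions.\<close>

lemma general_recursive_finite_support:
  assumes "general_recursive f"
  shows "\<exists>N. \<forall>xs ys. (\<forall>i<N. nth_arg i xs = nth_arg i ys) \<longrightarrow> f xs = f ys"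
  using assms
proof induction
  case zero
  then show ?case by simp
next
  case succ
  then show ?case by (intro exI[of _ 1]) simp
next
  case (proj i)
  then show ?case by (intro exI[of _ "Suc i"]) simp
next
  case (comp g fs)
  then obtain N where
    "\<And>f xs ys. f \<in> set fs \<Longrightarrow> \<forall>i<N f. nth_arg i xs = nth_arg i ys \<Longrightarrow> f xs = f ys"
    by metis
  moreover have "N f \<le> sum_list (map N fs)" if "f \<in> set fs" for f
    using that member_le_sum_list[of "N f" "map N fs"] by auto
  ultimately have "\<And>f xs ys. f \<in> set fs \<Longrightarrow>
      \<forall>i<sum_list (map N fs). nth_arg i xs = nth_arg i ys \<Longrightarrow> f xs = f ys"
    by (meson less_le_trans)
  then show ?case
    by (intro exI[of _ "sum_list (map N fs)"] allI impI arg_cong[of _ _ g] map_cong) auto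
next
  case (prec f g)
  from prec.IH obtain N M where
    N: "\<And>xs ys. \<forall>i<N. nth_arg i xs = nth_arg i ys \<Longrightarrow> f xs = f ys" and
    M: "\<And>xs ys. \<forall>i<M. nth_arg i xs = nth_arg i ys \<Longrightarrow> g xs = g ys"
    by blast
  \<comment> \<open>\<open>Suc\<close> makes room for the recursion argument at position 0, which
    \<open>tl\<close> removes for \<open>f\<close> and \<open>g\<close>.\<close>
  show ?case
  proof (intro exI[of _ "Suc (N + M)"] allI impI)
    fix xs ys assume eq: "\<forall>i<Suc (N + M). nth_arg i xs = nth_arg i ys"
    have "f (tl xs) = f (tl ys)" using eq by (intro N) (simp add: nth_arg_tl)
    moreover have "g (r # n # tl xs) = g (r # n # tl ys)" for r n
    proof (intro M allI impI)
      fix i assume "i < M"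
      then show "nth_arg i (r # n # tl xs) = nth_arg i (r # n # tl ys)"
        using eq by (cases i; cases "i - 1") (simp_all add: nth_arg_tl)
    qed
    ultimately show "rec_nat (f (tl xs)) (\<lambda>n r. g (r # n # tl xs)) (nth_arg 0 xs) =
        rec_nat (f (tl ys)) (\<lambda>n r. g (r # n # tl ys)) (nth_arg 0 ys)"
      using eq by simp
  qed
next
  case (minimize f)
  then obtain N where N: "\<And>xs ys. \<forall>i<N. nth_arg i xs = nth_arg i ys \<Longrightarrow> f xs = f ys"
    by blast
  show ?case
  proof (intro exI[of _ N] allI impI)
    fix xs ys assume eq: "\<forall>i<N. nth_arg i xs = nth_arg i ys"
    have "f (n # xs) = f (n # ys)" for n
    proof (intro N allI impI)
      fix i assume "i < N"
      then show "nth_arg i (n # xs) = nth_arg i (n # ys)" using eq by (cases i) auto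
    qed
    then show "(LEAST n. f (n # xs) = 0) = (LEAST n. f (n # ys) = 0)" by simp
  qed
qed

text \<open>Finite support reduces an arbitrary change of arguments to \<open>comp\<close>.\<close>

lemma general_recursive_subst:
  assumes "general_recursive f" "\<And>i. general_recursive (\<lambda>xs. nth_arg i (\<sigma> xs))"
  shows "general_recursive (\<lambda>xs. f (\<sigma> xs))"
proof -
  obtain N where N: "\<And>xs ys. \<forall>i<N. nth_arg i xs = nth_arg i ys \<Longrightarrow> f xs = f ys"
    using general_recursive_finite_support[OF assms(1)] by blast
  let ?fs = "map (\<lambda>i xs. nth_arg i (\<sigma> xs)) [0..<N]"
  have "f (\<sigma> xs) = f (map (\<lambda>f. f xs) ?fs)" for xs
    by (rule N) (simp add: nth_arg_def)
  moreover have "general_recursive (\<lambda>xs. f (map (\<lambda>f. f xs) ?fs))"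
    using assms by (intro general_recursive.comp) auto
  ultimately show ?thesis by simp
qed

text \<open>Truth is coded as 0, so that \<open>minimize\<close> finds the least number making a
  relation true.\<close>

definition decidable :: "(nat list \<Rightarrow> bool) \<Rightarrow> bool" where
  "decidable P \<longleftrightarrow> general_recursive (\<lambda>xs. if P xs then 0 else 1)"

section \<open>Closure rules for arithmetic, logic and minimization\<close>

named_theorems rec_intros

lemmas [rec_intros] = general_recursive.proj

lemma general_recursive_Cons_subst:
  assumes "general_recursive f" "general_recursive t" "general_recursive s"
  shows "general_recursive (\<lambda>xs. f (t xs # xs))"
    and "general_recursive (\<lambda>xs. f (t xs # tl xs))"
    and "general_recursive (\<lambda>xs. f [t xs])"
    and "general_recursive (\<lambda>xs. f [t xs, s xs])"
proof -
  have z: "nth_arg i [] = 0" for i by (simp add: nth_arg_def)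
  have "general_recursive (\<lambda>xs. nth_arg i (t xs # xs))"
    "general_recursive (\<lambda>xs. nth_arg i (t xs # tl xs))"
    "general_recursive (\<lambda>xs. nth_arg i [t xs])" for i
    using assms(2) by (cases i; simp add: nth_arg_tl z general_recursive.zero general_recursive.proj)+
  then show "general_recursive (\<lambda>xs. f (t xs # xs))"
    "general_recursive (\<lambda>xs. f (t xs # tl xs))" "general_recursive (\<lambda>xs. f [t xs])"
    using assms(1) by (auto intro: general_recursive_subst)
  show "general_recursive (\<lambda>xs. f [t xs, s xs])"
    using general_recursive.comp[OF assms(1), of "[t, s]"] assms by simp
qed

lemma general_recursive_tl:
  "general_recursive f \<Longrightarrow> general_recursive (\<lambda>xs. f (tl xs))"
  by (rule general_recursive_subst) (simp_all add: nth_arg_tl general_recursive.proj)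

lemma general_recursive_app1:
  assumes "general_recursive (\<lambda>xs. f (nth_arg 0 xs))" "general_recursive t"
  shows "general_recursive (\<lambda>xs. f (t xs))"
  using general_recursive_Cons_subst(3)[OF assms assms(2)] by simp

lemma general_recursive_app2:
  assumes "general_recursive (\<lambda>xs. f (nth_arg 0 xs) (nth_arg 1 xs))"
    "general_recursive t" "general_recursive s"
  shows "general_recursive (\<lambda>xs. f (t xs) (s xs))"
  using general_recursive_Cons_subst(4)[OF assms] by simp

text \<open>\<open>prec\<close> recurses on the head of the list, so \<open>k xs\<close> is prefixed
  and all of \<open>xs\<close> remains as parameters. In the premise on \<open>g\<close>, position 0
  holds the previous value and position 1 the counter.\<close>

lemma general_recursive_rec_nat:
  assumes "general_recursive k" "general_recursive f"
    and g: "general_recursive (\<lambda>xs. g (nth_arg 1 xs) (nth_arg 0 xs) (tl (tl xs)))"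
  shows "general_recursive (\<lambda>xs. rec_nat (f xs) (\<lambda>n r. g n r xs) (k xs))"
  using general_recursive_Cons_subst(1)[OF general_recursive.prec[OF assms(2) g] assms(1) assms(1)]
  by simp

lemma general_recursive_Suc [rec_intros]:
  "general_recursive t \<Longrightarrow> general_recursive (\<lambda>xs. Suc (t xs))"
  by (rule general_recursive_app1[OF general_recursive.succ])

lemma general_recursive_const [rec_intros]: "general_recursive (\<lambda>xs. c)"
proof (induction c)
  case (Suc c)
  then show ?case by (rule general_recursive_Suc)
qed (rule general_recursive.zero)

lemma general_recursive_add [rec_intros]:
  assumes "general_recursive s" "general_recursive t"
  shows "general_recursive (\<lambda>xs. s xs + t xs)"
proof -
  have "a + b = rec_nat a (\<lambda>n r. Suc r) b" for a b :: nat
    by (induction b) simp_all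
  then show ?thesis
    using assms by (auto intro!: general_recursive_rec_nat rec_intros)
qed

lemma general_recursive_pred:
  assumes "general_recursive t"
  shows "general_recursive (\<lambda>xs. t xs - 1)"
proof -
  have "t xs - 1 = rec_nat 0 (\<lambda>n r. n) (t xs)" for xs
    by (cases "t xs") simp_all
  then show ?thesis
    using assms by (auto intro!: general_recursive_rec_nat rec_intros)
qed

lemma general_recursive_diff [rec_intros]:
  assumes "general_recursive s" "general_recursive t"
  shows "general_recursive (\<lambda>xs. s xs - t xs)"
proof -
  have "a - b = rec_nat a (\<lambda>n r. r - 1) b" for a b :: nat
    by (induction b) simp_all
  then have "s xs - t xs = rec_nat (s xs) (\<lambda>n r. r - 1) (t xs)" for xs .
  moreover have "general_recursive (\<lambda>xs. rec_nat (s xs) (\<lambda>n r. r - 1) (t xs))"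
    using assms by (intro general_recursive_rec_nat general_recursive_pred rec_intros)
  ultimately show ?thesis by (simp only:)
qed

lemma general_recursive_if [rec_intros]:
  assumes "decidable P" "general_recursive s" "general_recursive t"
  shows "general_recursive (\<lambda>xs. if P xs then s xs else t xs)"
proof -
  have "(if P xs then s xs else t xs) = rec_nat (s xs) (\<lambda>n r. t xs) (if P xs then 0 else 1)" for xs
    by simp
  moreover have "general_recursive (\<lambda>xs. rec_nat (s xs) (\<lambda>n r. t xs) (if P xs then 0 else 1))"
    using assms unfolding decidable_def
    by (intro general_recursive_rec_nat general_recursive_tl[OF general_recursive_tl])
  ultimately show ?thesis by simp
qed

lemma if_not_swap: "(if \<not> P then x else y) = (if P then y else x)"
  by simp

lemma decidable_not [rec_intros]: "decidable P \<Longrightarrow> decidable (\<lambda>xs. \<not> P xs)"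
  unfolding decidable_def[of "\<lambda>xs. \<not> P xs"] if_not_swap by (intro rec_intros)

lemma decidable_conj [rec_intros]:
  assumes "decidable P" "decidable Q"
  shows "decidable (\<lambda>xs. P xs \<and> Q xs)"
proof -
  have "(if P xs \<and> Q xs then 0 else 1) = (if P xs then if Q xs then 0 else 1 else (1::nat))" for xs
    by simp
  then show ?thesis
    using assms unfolding decidable_def[of "\<lambda>xs. P xs \<and> Q xs"]
    by (simp only:) (intro rec_intros)
qed

lemma decidable_disj [rec_intros]:
  assumes "decidable P" "decidable Q"
  shows "decidable (\<lambda>xs. P xs \<or> Q xs)"
proof -
  have "decidable (\<lambda>xs. \<not> (\<not> P xs \<and> \<not> Q xs))" using assms by (intro rec_intros)
  then show ?thesis by simp
qed

lemma decidable_imp [rec_intros]: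
  assumes "decidable P" "decidable Q"
  shows "decidable (\<lambda>xs. P xs \<longrightarrow> Q xs)"
proof -
  have "decidable (\<lambda>xs. \<not> P xs \<or> Q xs)" using assms by (intro rec_intros)
  then show ?thesis by (simp only: imp_conv_disj)
qed

lemma decidable_eq [rec_intros]:
  assumes "general_recursive s" "general_recursive t"
  shows "decidable (\<lambda>xs. s xs = t xs)"
proof -
  \<comment> \<open>Subtraction is truncated: the sum is 0 exactly for equal numbers, and the double
    complement caps it at 1.\<close>
  have "(if s xs = t xs then 0 else 1) = 1 - (1 - ((s xs - t xs) + (t xs - s xs)))" for xs
    by auto
  then show ?thesis
    using assms unfolding decidable_def by (simp only:) (intro rec_intros)
qed

lemma decidable_less [rec_intros]:
  assumes "general_recursive s" "general_recursive t"
  shows "decidable (\<lambda>xs. s xs < t xs)"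
proof -
  have "decidable (\<lambda>xs. Suc (s xs) - t xs = 0)" using assms by (intro rec_intros)
  then show ?thesis by (simp add: Suc_le_eq)
qed

text \<open>The bound variable is prefixed to the arguments, hence read at position 0 with the old
  arguments in the tail. The search is a primitive recursion on the bound.\<close>

lemma decidable_bex_less [rec_intros]:
  assumes "general_recursive b" "decidable (\<lambda>xs. P (nth_arg 0 xs) (tl xs))"
  shows "decidable (\<lambda>xs. \<exists>n<b xs. P n xs)"
proof -
  have "(if \<exists>n<k. P n xs then 0 else 1) = rec_nat (1::nat) (\<lambda>n r. if P n xs then 0 else r) k" for k xs
  proof (induction k)
    case (Suc k)
    have "(\<exists>n<Suc k. P n xs) \<longleftrightarrow> P k xs \<or> (\<exists>n<k. P n xs)"
      using less_Suc_eq by metis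
    with Suc.IH show ?case by (simp only: old.nat.simps(7)) simp
  qed simp
  moreover have "general_recursive (\<lambda>xs. rec_nat 1 (\<lambda>n r. if P n xs then 0 else r) (b xs))"
  proof (intro general_recursive_rec_nat rec_intros assms(1))
    \<comment> \<open>Inside the recursion the previous value precedes the counter;
      \<open>general_recursive_tl\<close> skips it.\<close>
    show "decidable (\<lambda>xs. P (nth_arg 1 xs) (tl (tl xs)))"
      using general_recursive_tl[OF assms(2)[unfolded decidable_def]]
      by (simp add: decidable_def nth_arg_tl)
  qed
  ultimately show ?thesis by (simp only: decidable_def)
qed

lemma decidable_ball_less [rec_intros]:
  assumes "general_recursive b" "decidable (\<lambda>xs. P (nth_arg 0 xs) (tl xs))"
  shows "decidable (\<lambda>xs. \<forall>n<b xs. P n xs)"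
proof -
  have "decidable (\<lambda>xs. \<not> (\<exists>n<b xs. \<not> P n xs))" using assms by (intro rec_intros)
  then show ?thesis by simp
qed

lemma general_recursive_Least:
  assumes "decidable (\<lambda>xs. P (nth_arg 0 xs) (tl xs))" "\<And>xs. \<exists>n. P n xs"
  shows "general_recursive (\<lambda>xs. LEAST n. P n xs)"
proof -
  have "\<forall>xs. \<exists>n. (if P (nth_arg 0 (n # xs)) (tl (n # xs)) then 0 else 1) = (0::nat)"
    using assms(2) by auto
  from general_recursive.minimize[OF assms(1)[unfolded decidable_def] this]
  have "general_recursive (\<lambda>xs. LEAST n. (if P n xs then 0 else 1) = (0::nat))" by simp
  moreover have "(if Q then 0 else 1) = (0::nat) \<longleftrightarrow> Q" for Q by simp
  ultimately show ?thesis by simp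
qed

lemma Least_eq_self: "(LEAST n. n = (a :: nat)) = a"
  by (rule Least_equality) auto

section \<open>Operations on list codes\<close>

lemma general_recursive_prod_encode [rec_intros]:
  assumes "general_recursive s" "general_recursive t"
  shows "general_recursive (\<lambda>xs. prod_encode (s xs, t xs))"
proof -
  have "triangle k = rec_nat 0 (\<lambda>n r. r + Suc n) k" for k
    by (induction k) simp_all
  then show ?thesis
    using assms by (auto simp: prod_encode_def intro!: general_recursive_rec_nat rec_intros)
qed

text \<open>Pairing is inverted by searching for the first component. The second one never exceeds
  the code, so its quantifier can be bounded.\<close>

lemma general_recursive_fst_prod_decode [rec_intros]:
  assumes "general_recursive t"
  shows "general_recursive (\<lambda>xs. fst (prod_decode (t xs)))"
proof (rule general_recursive_app1[OF _ assms])
  have eq: "(\<exists>n<Suc z. prod_encode (m, n) = z) \<longleftrightarrow> m = fst (prod_decode z)" for m z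
    by (metis fst_conv le_imp_less_Suc le_prod_encode_2 prod.collapse prod_decode_inverse
        prod_encode_inverse)
  have "general_recursive (\<lambda>xs. LEAST m. \<exists>n<Suc (nth_arg 0 xs). prod_encode (m, n) = nth_arg 0 xs)"
  proof (rule general_recursive_Least)
    \<comment> \<open>Each quantified or searched variable shifts the argument list;
      \<open>nth_arg_tl\<close> turns the shift into a larger index before the closure rules go
      on.\<close>
    show "decidable (\<lambda>xs. \<exists>n<Suc (nth_arg 0 (tl xs)). prod_encode (nth_arg 0 xs, n) = nth_arg 0 (tl xs))"
      by (simp only: nth_arg_tl) (intro rec_intros, (simp only: nth_arg_tl, intro rec_intros)+)
  qed (simp add: eq)
  then show "general_recursive (\<lambda>xs. fst (prod_decode (nth_arg 0 xs)))"
    by (simp add: eq Least_eq_self)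
qed

lemma general_recursive_snd_prod_decode [rec_intros]:
  assumes "general_recursive t"
  shows "general_recursive (\<lambda>xs. snd (prod_decode (t xs)))"
proof (rule general_recursive_app1[OF _ assms])
  have eq: "prod_encode (fst (prod_decode z), n) = z \<longleftrightarrow> n = snd (prod_decode z)" for n z
    by (metis prod.collapse prod_decode_inverse prod_encode_inverse snd_conv)
  have "general_recursive
      (\<lambda>xs. LEAST n. prod_encode (fst (prod_decode (nth_arg 0 xs)), n) = nth_arg 0 xs)"
    by (rule general_recursive_Least) (simp only: nth_arg_tl, intro rec_intros, simp add: eq)
  then show "general_recursive (\<lambda>xs. snd (prod_decode (nth_arg 0 xs)))"
    by (simp add: eq Least_eq_self)
qed

definition code_drop :: "nat \<Rightarrow> nat \<Rightarrow> nat" where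
  "code_drop n c = list_encode (drop n (list_decode c))"

definition code_take :: "nat \<Rightarrow> nat \<Rightarrow> nat" where
  "code_take n c = list_encode (take n (list_decode c))"

definition code_length :: "nat \<Rightarrow> nat" where
  "code_length c = length (list_decode c)"

definition code_nth :: "nat \<Rightarrow> nat \<Rightarrow> nat" where
  "code_nth c i = nth_arg i (list_decode c)"

text \<open>A nonempty list is coded by the successor of the pair of its head and the code of its
  tail. Unpairing the predecessor thus gives the tail, and \<open>drop\<close> iterates
  this.\<close>

lemma general_recursive_code_drop [rec_intros]:
  assumes "general_recursive s" "general_recursive t"
  shows "general_recursive (\<lambda>xs. code_drop (s xs) (t xs))"
proof -
  have tl: "list_encode (tl l) = (let c = list_encode l in if c = 0 then 0 else snd (prod_decode (c - 1)))"
    for l by (cases l) (simp_all add: prod_encode_inverse)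
  have "code_drop n c = rec_nat c (\<lambda>k r. if r = 0 then 0 else snd (prod_decode (r - 1))) n" for n c
    by (induction n) (simp_all add: code_drop_def list_decode_inverse drop_Suc drop_tl tl[unfolded Let_def])
  then show ?thesis
    using assms by (auto intro!: general_recursive_rec_nat rec_intros)
qed

lemma general_recursive_code_nth [rec_intros]:
  assumes "general_recursive s" "general_recursive t"
  shows "general_recursive (\<lambda>xs. code_nth (s xs) (t xs))"
proof -
  have "nth_arg 0 l = (if list_encode l = 0 then 0 else fst (prod_decode (list_encode l - 1)))" for l
    by (cases l) (simp_all add: prod_encode_inverse nth_arg_def)
  moreover have "nth_arg i l = nth_arg 0 (drop i l)" for i l
    by (auto simp: nth_arg_def)
  ultimately have "code_nth c i = (if code_drop i c = 0 then 0 else fst (prod_decode (code_drop i c - 1)))"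
    for c i by (simp add: code_nth_def code_drop_def)
  then show ?thesis
    using assms by (auto intro!: rec_intros)
qed

lemma list_encode_eq_0: "list_encode l = 0 \<longleftrightarrow> l = []"
  by (cases l) auto

lemma general_recursive_code_length [rec_intros]:
  assumes "general_recursive t"
  shows "general_recursive (\<lambda>xs. code_length (t xs))"
proof (rule general_recursive_app1[OF _ assms])
  have "code_length c = (LEAST n. code_drop n c = 0)" for c
    by (auto simp: code_length_def code_drop_def list_encode_eq_0 intro: Least_equality[symmetric])
  moreover have "general_recursive (\<lambda>xs. LEAST n. code_drop n (nth_arg 0 xs) = 0)"
    by (rule general_recursive_Least)
      (simp only: nth_arg_tl, intro rec_intros, auto simp: code_drop_def list_encode_eq_0)
  ultimately show "general_recursive (\<lambda>xs. code_length (nth_arg 0 xs))" by simp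
qed

lemma general_recursive_code_take [rec_intros]:
  assumes "general_recursive s" "general_recursive t"
  shows "general_recursive (\<lambda>xs. code_take (s xs) (t xs))"
proof (rule general_recursive_app2[OF _ assms])
  \<comment> \<open>The length equation forces the length of \<open>t\<close> to be the minimum of
    \<open>n\<close> and the length of \<open>c\<close>, also when \<open>n\<close> exceeds the
    latter. Together with the entries this determines \<open>t\<close>.\<close>
  define P where "P t n c \<longleftrightarrow> code_length t + code_length (code_drop n c) = code_length c \<and>
    (\<forall>i<code_length t. code_nth t i = code_nth c i)" for t n c
  have P: "P t n c \<longleftrightarrow> t = code_take n c" for t n c
  proof
    assume "P t n c"
    then have "length (list_decode t) + (length (list_decode c) - n) = length (list_decode c)"
      "\<forall>i<length (list_decode t). list_decode t ! i = list_decode c ! i"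
      by (auto simp: P_def code_length_def code_drop_def code_nth_def nth_arg_def list_encode_inverse
          split: if_splits)
    then have "list_decode t = take n (list_decode c)"
      by (intro nth_equalityI) auto
    then show "t = code_take n c" by (metis code_take_def list_decode_inverse)
  qed (auto simp: P_def code_take_def code_length_def code_drop_def code_nth_def nth_arg_def
      list_encode_inverse)
  have "general_recursive (\<lambda>xs. LEAST t. P t (nth_arg 0 xs) (nth_arg 1 xs))"
  proof (rule general_recursive_Least)
    show "decidable (\<lambda>xs. P (nth_arg 0 xs) (nth_arg 0 (tl xs)) (nth_arg 1 (tl xs)))"
      unfolding P_def
      by (simp only: nth_arg_tl) (intro rec_intros, (simp only: nth_arg_tl, intro rec_intros)+)
  qed (simp add: P)
  then show "general_recursive (\<lambda>xs. code_take (nth_arg 0 xs) (nth_arg 1 xs))"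
    by (simp add: P Least_eq_self)
qed

lemma decidable_bex_list [rec_intros]:
  assumes c: "general_recursive c" and P: "decidable (\<lambda>xs. P (nth_arg 0 xs) (tl xs))"
  shows "decidable (\<lambda>xs. \<exists>x\<in>set (list_decode (c xs)). P x xs)"
proof -
  have "(\<exists>x\<in>set (list_decode d). Q x) \<longleftrightarrow> (\<exists>i<code_length d. Q (code_nth d i))" for d Q
    by (auto simp: in_set_conv_nth code_length_def code_nth_def nth_arg_def Bex_def)
  moreover have "decidable (\<lambda>xs. \<exists>i<code_length (c xs). P (code_nth (c xs) i) xs)"
  proof (intro rec_intros c)
    have "general_recursive (\<lambda>xs. code_nth (c (tl xs)) (nth_arg 0 xs))"
      by (intro rec_intros general_recursive_tl c)
    \<comment> \<open>The position at the head of the arguments is replaced by the entry found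
      there.\<close>
    from general_recursive_Cons_subst(2)[OF P[unfolded decidable_def] this this]
    show "decidable (\<lambda>xs. P (code_nth (c (tl xs)) (nth_arg 0 xs)) (tl xs))"
      by (simp add: decidable_def)
  qed
  ultimately show ?thesis by simp
qed

lemma decidable_ball_list [rec_intros]:
  assumes "general_recursive c" "decidable (\<lambda>xs. P (nth_arg 0 xs) (tl xs))"
  shows "decidable (\<lambda>xs. \<forall>x\<in>set (list_decode (c xs)). P x xs)"
proof -
  have "decidable (\<lambda>xs. \<not> (\<exists>x\<in>set (list_decode (c xs)). \<not> P x xs))" using assms by (intro rec_intros)
  then show ?thesis by simp
qed

lemma decidable_member [rec_intros]:
  assumes "general_recursive t" "general_recursive c"
  shows "decidable (\<lambda>xs. t xs \<in> set (list_decode (c xs)))"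
proof -
  have "decidable (\<lambda>xs. \<exists>x\<in>set (list_decode (c xs)). x = t xs)"
    using assms by (intro rec_intros general_recursive_tl)
  then show ?thesis by simp
qed

section \<open>Computability\<close>

definition decode_list2 :: "nat \<Rightarrow> nat list list" where
  "decode_list2 e = map list_decode (list_decode e)"

lemma encode_decode_list2: "encode_words (decode_list2 e) = e"
  by (simp add: encode_words_def decode_list2_def list_decode_inverse comp_def)

lemma decode_encode_words: "decode_list2 (encode_words ws) = ws"
  by (simp add: encode_words_def decode_list2_def list_encode_inverse comp_def)

section \<open>Certificates as relations between codes\<close>

lemma inj_list_decode: "inj list_decode"
  by (metis injI list_decode_inverse)

text \<open>Rewriting with these moves \<open>list_decode\<close> outward and finally removes it,
  leaving formulas about numbers to which \<open>rec_intros\<close> applies.\<close>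

lemma code_simps:
  "list_decode x \<in> set (decode_list2 c) \<longleftrightarrow> x \<in> set (list_decode c)"
  "take n (list_decode x) = list_decode (code_take n x)"
  "drop n (list_decode x) = list_decode (code_drop n x)"
  "length (list_decode x) = code_length x"
  "list_decode x = list_decode y \<longleftrightarrow> x = y"
  "take n (decode_list2 c) = decode_list2 (code_take n c)"
  "length (decode_list2 c) = code_length c"
  "Bex (set (decode_list2 c)) P \<longleftrightarrow> (\<exists>x\<in>set (list_decode c). P (list_decode x))"
  "Ball (set (decode_list2 c)) P \<longleftrightarrow> (\<forall>x\<in>set (list_decode c). P (list_decode x))"
  by (auto simp: decode_list2_def code_take_def code_drop_def code_length_def list_encode_inverse
      take_map inj_image_mem_iff[OF inj_list_decode] inj_eq[OF inj_list_decode])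

lemma decode_list2_nth:
  "j < code_length c \<Longrightarrow> decode_list2 c ! j = list_decode (code_nth c j)"
  by (simp add: decode_list2_def code_length_def code_nth_def nth_arg_def)

lemma overlap_at_code:
  "overlap_at n (list_decode x) (list_decode y) \<longleftrightarrow>
     n < code_length x \<and> code_take (code_length x - n) y = code_drop n x"
  by (simp only: overlap_at_def code_simps)

lemma pieces_code:
  "list_decode z \<in> pieces n (list_decode x) (list_decode y) \<longleftrightarrow>
     z = code_take n x \<or> z = code_drop n x \<or> z = code_drop (code_length x - n) y"
  by (simp add: pieces_def code_simps)

lemma derivation_code:
  "derivation (decode_list2 e) (decode_list2 c) \<longleftrightarrow>
     (\<forall>j<code_length c. code_nth c j \<in> set (list_decode e) \<or>
       (\<exists>x\<in>set (list_decode (code_take j c)). \<exists>y\<in>set (list_decode (code_take j c)).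
          \<exists>n<code_length x. (n < code_length x \<and> code_take (code_length x - n) y = code_drop n x) \<and>
            (code_nth c j = code_take n x \<or> code_nth c j = code_drop n x \<or>
             code_nth c j = code_drop (code_length x - n) y)))"
  unfolding derivation_def code_simps
  by (simp add: decode_list2_nth code_simps overlap_at_code pieces_code cong: conj_cong)

text \<open>An overlap at \<open>n\<close> forces \<open>n < length u\<close>, which turns the
  quantifier over all \<open>n\<close> into a bounded one.\<close>

lemma overlap_closed_code:
  "overlap_closed (set (decode_list2 c)) \<longleftrightarrow>
     (\<forall>x\<in>set (list_decode c). \<forall>y\<in>set (list_decode c). \<forall>n<code_length x.
        code_take (code_length x - n) y = code_drop n x \<longrightarrow>
          code_take n x \<in> set (list_decode c) \<and> code_drop n x \<in> set (list_decode c) \<and>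
          code_drop (code_length x - n) y \<in> set (list_decode c))"
  unfolding overlap_closed_def code_simps by (auto simp: overlap_at_code pieces_def code_simps)

text \<open>The first factor fixes the splitting point, so concatenation is expressed by
  \<open>code_take\<close> and \<open>code_drop\<close>.\<close>

lemma append_code:
  "list_decode z = list_decode x @ list_decode y \<longleftrightarrow>
     code_take (code_length x) z = x \<and> code_drop (code_length x) z = y"
proof -
  have "list_decode z = list_decode x @ list_decode y \<longleftrightarrow>
      take (length (list_decode x)) (list_decode z) = list_decode x \<and>
      drop (length (list_decode x)) (list_decode z) = list_decode y"
    by (metis append_eq_conv_conj append_take_drop_id)
  then show ?thesis by (simp only: code_simps)
qed

lemma Nil_code: "list_decode x = [] \<longleftrightarrow> x = 0"
  by (metis list_decode.simps(1) list_decode_inverse)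

lemma irreducibles_code:
  "set (decode_list2 t) = irreducibles (set (decode_list2 c)) \<longleftrightarrow>
     (let Q = (\<lambda>z. \<not> z = 0 \<and> (\<forall>x\<in>set (list_decode c). \<forall>y\<in>set (list_decode c). \<not> x = 0 \<longrightarrow> \<not> y = 0 \<longrightarrow>
        \<not> (code_take (code_length x) z = x \<and> code_drop (code_length x) z = y)))
      in (\<forall>z\<in>set (list_decode t). z \<in> set (list_decode c) \<and> Q z) \<and>
         (\<forall>z\<in>set (list_decode c). Q z \<longrightarrow> z \<in> set (list_decode t)))"
proof -
  \<comment> \<open>Equality splits into two inclusions; as \<open>irreducibles C\<close> lies in
    \<open>C\<close>, both can be checked on the entries of lists.\<close>
  have "A = irreducibles C \<longleftrightarrow> (\<forall>z\<in>A. z \<in> C \<and> z \<in> irreducibles C) \<and>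
      (\<forall>z\<in>C. z \<in> irreducibles C \<longrightarrow> z \<in> A)" for A C :: "nat list set"
    by (auto simp: irreducibles_def)
  moreover have "list_decode z \<in> irreducibles (set (decode_list2 c)) \<longleftrightarrow>
      z \<in> set (list_decode c) \<and> \<not> z = 0 \<and>
      (\<forall>x\<in>set (list_decode c). \<forall>y\<in>set (list_decode c). \<not> x = 0 \<longrightarrow> \<not> y = 0 \<longrightarrow>
        \<not> (code_take (code_length x) z = x \<and> code_drop (code_length x) z = y))" for z
    by (simp add: irreducibles_def code_simps Nil_code append_code)
  ultimately show ?thesis by (simp add: code_simps Let_def)
qed

text \<open>The number to be searched for packs \<open>cs\<close> and \<open>ts\<close> into a pair
  and stands at position 0, where \<open>minimize\<close> places it; the input stands at position
  1.\<close>

lemma decidable_certificate: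
  "decidable (\<lambda>xs. certificate (decode_list2 (nth_arg 1 xs))
     (decode_list2 (fst (prod_decode (nth_arg 0 xs)))) (decode_list2 (snd (prod_decode (nth_arg 0 xs)))))"
  unfolding certificate_def subset_eq derivation_code overlap_closed_code irreducibles_code Let_def
    code_simps
  by (intro rec_intros; (simp only: nth_arg_tl, intro rec_intros)+)

lemma computable_certificate:
  "\<exists>F. computable_on_words F \<and> (\<forall>ws. \<exists>cs. certificate ws cs (F ws))"
proof -
  define P where "P z e \<longleftrightarrow> certificate (decode_list2 e) (decode_list2 (fst (prod_decode z)))
    (decode_list2 (snd (prod_decode z)))" for z e
  \<comment> \<open>Every number is the code of a list of words, so the search succeeds for all
    arguments, as \<open>minimize\<close> demands.\<close>
  have ex: "\<exists>z. P z e" for e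
  proof -
    obtain cs ts where "certificate (decode_list2 e) cs ts" using certificate_exists by blast
    then have "P (prod_encode (encode_words cs, encode_words ts)) e"
      by (simp add: P_def prod_encode_inverse decode_encode_words)
    then show ?thesis ..
  qed
  define g where "g xs = snd (prod_decode (LEAST z. P z (nth_arg 0 xs)))" for xs
  have "general_recursive g" unfolding g_def
    using decidable_certificate
    by (intro rec_intros general_recursive_Least ex) (simp add: P_def nth_arg_tl)
  define F where "F ws = decode_list2 (g [encode_words ws])" for ws
  have "computable_on_words F"
    unfolding computable_on_words_def using \<open>general_recursive g\<close>
    by (auto simp: F_def encode_decode_list2)
  moreover have "\<exists>cs. certificate ws cs (F ws)" for ws
    using LeastI_ex[OF ex[of "encode_words ws"]]
    by (auto simp: F_def g_def P_def[of _ "encode_words ws"] decode_encode_words)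
  ultimately show ?thesis by blast
qed

theorem proposition3p2:
  "(\<forall>(X :: 'a set) S. finite S \<and> S \<subseteq> lists X \<longrightarrow>
      (\<exists>T. finite T \<and> T \<subseteq> lists X - {[]} \<and> overlap_free T \<and>
         inverse_equivalent (free_monoid X) S T)) \<and>
   (\<exists>F. computable_on_words F \<and>
      (\<forall>(X :: 'a set) d ws. inj_on d (letters ws) \<and> decode_words d ws \<subseteq> lists X \<longrightarrow>
         (let S = decode_words d ws; T = decode_words d (F ws)
          in finite T \<and> T \<subseteq> lists X - {[]} \<and> overlap_free T \<and>
             inverse_equivalent (free_monoid X) S T)))"
proof (intro conjI allI impI)
  fix X :: "'a set" and S assume S: "finite S \<and> S \<subseteq> lists X"
  then obtain ws where ws: "set ws = S" using finite_list by metis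
  \<comment> \<open>Certificates exist over letters of any type, so here the letters stay uncoded
    and the decoding is \<open>id\<close>.\<close>
  obtain cs ts where "certificate ws cs ts" using certificate_exists by blast
  then have "finite (set ts) \<and> set ts \<subseteq> lists X - {[]} \<and> overlap_free (set ts) \<and>
      inverse_equivalent (free_monoid X) S (set ts)"
    by (rule certificate_sound[where d = id]) (use ws S in simp_all)
  then show "\<exists>T. finite T \<and> T \<subseteq> lists X - {[]} \<and> overlap_free T \<and>
      inverse_equivalent (free_monoid X) S T" ..
next
  \<comment> \<open>Certificates concern code words only, so \<open>F\<close> can be fixed before
    \<open>X\<close> and \<open>d\<close>.\<close>
  obtain F where F: "computable_on_words F" "\<And>ws. \<exists>cs. certificate ws cs (F ws)"
    using computable_certificate by metis
  have "let S = decode_words d ws; T = decode_words d (F ws)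
      in finite T \<and> T \<subseteq> lists X - {[]} \<and> overlap_free T \<and> inverse_equivalent (free_monoid X) S T"
    if "inj_on d (letters ws) \<and> decode_words d ws \<subseteq> lists X" for X :: "'a set" and d ws
  proof -
    obtain cs where "certificate ws cs (F ws)" using F(2) by blast
    then show ?thesis
      unfolding Let_def using that
      by (intro certificate_sound[where d = d]) (simp_all add: decode_words_def)
  qed
  with F(1) show "\<exists>F. computable_on_words F \<and>
      (\<forall>(X :: 'a set) d ws. inj_on d (letters ws) \<and> decode_words d ws \<subseteq> lists X \<longrightarrow>
         (let S = decode_words d ws; T = decode_words d (F ws)
          in finite T \<and> T \<subseteq> lists X - {[]} \<and> overlap_free T \<and>
             inverse_equivalent (free_monoid X) S T))"
    by (intro exI[of _ F] conjI allI impI)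
qed

end
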